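(* Let $F_g$ be the oriented closed connected surface of genus $g\ge 1$, let $f$ be an orientation-preserving self-diffeomorphism of $F_g$, and let $q_0$ be an $f$-invariant quadratic form on $H_1(F_g;\mathbb{Z}_2)$. Let $\{\xi_1,\xi_2,\dots,\xi_d\}$ be a basis of the $\mathbb{Z}_2$-vector space of $\mathbb{Z}_2$-linear maps $$\{\xi:H_1(F_g;\mathbb{Z}_2)\to\mathbb{Z}_2\mid \xi\circ(f_*-\mathrm{id})=0\}.$$ Then there exists an $f$-invariant quadratic form on $H_1(F_g;\mathbb{Z}_2)$ with Arf invariant $0$ if and only if $0$ belongs to the set $$\{\mathrm{Arf}(q_0),\ \mathrm{Arf}(q_0+\xi_i),\ \mathrm{Arf}(q_0+\xi_i+\xi_j)\mid i,j=1,2,\dots,d,\ i\ne j\}.$$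
   Context: $\mathbb{Z}_2=\mathbb{Z}/2$, and $x\cdot y$ is the mod-2 intersection number on $H_1(F_g;\mathbb{Z}_2)$. A quadratic form on $H_1(F_g;\mathbb{Z}_2)$ is a function $q:H_1(F_g;\mathbb{Z}_2)\to\mathbb{Z}_2$ with $q(x+y)=q(x)+q(y)+x\cdot y$ for all $x,y$. The pull-back is $(f^*q)(x)=q(f_*(x))$, and $q$ is $f$-invariant if $f^*q=q$. The sum of a quadratic form $q$ and a $\mathbb{Z}_2$-linear map $\xi$ is the function $x\mapsto q(x)+\xi(x)$, which is again a quadratic form. The Arf invariant is $\mathrm{Arf}(q)=\sum_{i=1}^g q(a_i)q(b_i)\in\mathbb{Z}_2$, where $\{a_1,b_1,\dots,a_g,b_g\}$ is any symplectic basis of $H_1(F_g;\mathbb{Z}_2)$ (i.e. $a_i\cdot b_j=1$ iff $i=j$, and $a_i\cdot a_j=b_i\cdot b_j=0$ for all $i,j$); it is independent of the choice of symplectic basis. *)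

theory Defs
  imports "HOL-Analysis.Analysis" "HOL-Homology.Homology" "HOL-Library.Z2"
begin

section \<open>Smooth maps between open subsets of Euclidean spaces\<close>

primrec Ck_on :: "nat \<Rightarrow> 'a::euclidean_space set \<Rightarrow> ('a \<Rightarrow> 'b::euclidean_space) \<Rightarrow> bool" where
  "Ck_on 0 S h \<longleftrightarrow> continuous_on S h"
| "Ck_on (Suc k) S h \<longleftrightarrow>
     (\<forall>x\<in>S. h differentiable (at x)) \<and> (\<forall>v. Ck_on k S (\<lambda>x. frechet_derivative h (at x) v))"

text \<open>Meant for open \<open>S\<close>: the values of \<open>h\<close> outside \<open>S\<close> are then irrelevant.\<close>
definition smooth_on :: "'a::euclidean_space set \<Rightarrow> ('a \<Rightarrow> 'b::euclidean_space) \<Rightarrow> bool" where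
  "smooth_on S h \<longleftrightarrow> (\<forall>k. Ck_on k S h)"

definition positive_jacobian_on :: "(real^2) set \<Rightarrow> (real^2 \<Rightarrow> real^2) \<Rightarrow> bool" where
  "positive_jacobian_on S h \<longleftrightarrow> (\<forall>x\<in>S. det (matrix (frechet_derivative h (at x))) > 0)"

section \<open>Oriented closed connected surfaces\<close>

type_synonym 'a chart = "'a set \<times> ('a \<Rightarrow> real^2)"

text \<open>A smooth structure together with an orientation is given by an atlas whose transition
  maps are smooth with positive Jacobian determinant.\<close>
definition oriented_atlas :: "'a topology \<Rightarrow> 'a chart set \<Rightarrow> bool" where
  "oriented_atlas X A \<longleftrightarrow>
     (\<Union>(U, \<phi>)\<in>A. U) = topspace X \<and>
     (\<forall>(U, \<phi>)\<in>A. openin X U \<and> open (\<phi> ` U) \<and>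
        homeomorphic_map (subtopology X U) (top_of_set (\<phi> ` U)) \<phi>) \<and>
     (\<forall>(U, \<phi>)\<in>A. \<forall>(V, \<psi>)\<in>A.
        smooth_on (\<phi> ` (U \<inter> V)) (\<psi> \<circ> inv_into U \<phi>) \<and>
        positive_jacobian_on (\<phi> ` (U \<inter> V)) (\<psi> \<circ> inv_into U \<phi>))"

text \<open>Second countability follows from compactness.\<close>
definition oriented_closed_connected_surface :: "'a topology \<Rightarrow> 'a chart set \<Rightarrow> bool" where
  "oriented_closed_connected_surface X A \<longleftrightarrow>
     topspace X \<noteq> {} \<and> Hausdorff_space X \<and> compact_space X \<and> connected_space X \<and>
     oriented_atlas X A"

definition nonseparating_curves :: "'a topology \<Rightarrow> 'a set set \<Rightarrow> bool" where
  "nonseparating_curves X \<C> \<longleftrightarrow>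
     finite \<C> \<and> disjoint \<C> \<and>
     (\<forall>C\<in>\<C>. C \<subseteq> topspace X \<and>
        subtopology X C homeomorphic_space top_of_set (sphere (0::real^2) 1)) \<and>
     connected_space (subtopology X (topspace X - \<Union>\<C>))"

text \<open>The genus is the largest number of pairwise disjoint simple closed curves along which
  the surface can be cut without becoming disconnected.\<close>
definition has_genus :: "'a topology \<Rightarrow> nat \<Rightarrow> bool" where
  "has_genus X g \<longleftrightarrow>
     (\<exists>\<C>. nonseparating_curves X \<C> \<and> card \<C> = g) \<and>
     (\<forall>\<C>. nonseparating_curves X \<C> \<longrightarrow> card \<C> \<le> g)"

definition smooth_self_map :: "'a topology \<Rightarrow> 'a chart set \<Rightarrow> ('a \<Rightarrow> 'a) \<Rightarrow> bool" where
  "smooth_self_map X A f \<longleftrightarrow> continuous_map X X f \<and>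
     (\<forall>(U, \<phi>)\<in>A. \<forall>(V, \<psi>)\<in>A. smooth_on (\<phi> ` {x\<in>U. f x \<in> V}) (\<psi> \<circ> f \<circ> inv_into U \<phi>))"

definition orientation_preserving_diffeo :: "'a topology \<Rightarrow> 'a chart set \<Rightarrow> ('a \<Rightarrow> 'a) \<Rightarrow> bool" where
  "orientation_preserving_diffeo X A f \<longleftrightarrow>
     bij_betw f (topspace X) (topspace X) \<and>
     smooth_self_map X A f \<and> smooth_self_map X A (inv_into (topspace X) f) \<and>
     (\<forall>(U, \<phi>)\<in>A. \<forall>(V, \<psi>)\<in>A.
        positive_jacobian_on (\<phi> ` {x\<in>U. f x \<in> V}) (\<psi> \<circ> f \<circ> inv_into U \<phi>))"

section \<open>Singular homology with coefficients in \<open>\<int>/2\<close>\<close>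

text \<open>This is the homology of the complex \<open>C\<^sub>* \<otimes> \<int>/2 = C\<^sub>* / 2 C\<^sub>*\<close>, where \<open>C\<^sub>*\<close> is the integral
  singular chain complex. Mod 2 cycles and boundaries are represented by their preimages in
  \<open>C\<^sub>p\<close>, both of which contain \<open>2 C\<^sub>p\<close>.\<close>
definition mod2_cycle_group :: "nat \<Rightarrow> 'a topology \<Rightarrow> 'a chain monoid" where
  "mod2_cycle_group p X =
     \<lparr>carrier = {c. singular_chain p X c \<and>
                   (\<exists>d. singular_chain (p - 1) X d \<and> chain_boundary p c = frag_cmul 2 d)},
      monoid.mult = (+), one = 0\<rparr>"

definition mod2_boundaries :: "nat \<Rightarrow> 'a topology \<Rightarrow> 'a chain set" where
  "mod2_boundaries p X =
     {chain_boundary (Suc p) e + frag_cmul 2 d |e d.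
        singular_chain (Suc p) X e \<and> singular_chain p X d}"

definition mod2_homology_group :: "nat \<Rightarrow> 'a topology \<Rightarrow> 'a chain set monoid" where
  "mod2_homology_group p X = mod2_cycle_group p X Mod mod2_boundaries p X"

definition mod2_homology_class :: "nat \<Rightarrow> 'a topology \<Rightarrow> 'a chain \<Rightarrow> 'a chain set" where
  "mod2_homology_class p X c = mod2_boundaries p X #>\<^bsub>mod2_cycle_group p X\<^esub> c"

text \<open>The cosets in the union below are all equal.\<close>
definition mod2_hom_induced :: "nat \<Rightarrow> 'b topology \<Rightarrow> ('a \<Rightarrow> 'b) \<Rightarrow> 'a chain set \<Rightarrow> 'b chain set" where
  "mod2_hom_induced p Y f x = (\<Union>c\<in>x. mod2_homology_class p Y (chain_map p f c))"

abbreviation H1 :: "'a topology \<Rightarrow> 'a chain set monoid" where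
  "H1 X \<equiv> mod2_homology_group 1 X"

abbreviation H1_map :: "'a topology \<Rightarrow> ('a \<Rightarrow> 'a) \<Rightarrow> 'a chain set \<Rightarrow> 'a chain set" where
  "H1_map X f \<equiv> mod2_hom_induced 1 X f"

section \<open>The mod 2 intersection number\<close>

text \<open>Smooth closed curves \<open>\<real>/\<int> \<rightarrow> X\<close>, written as 1-periodic maps on \<open>\<real>\<close>.\<close>
definition smooth_loop :: "'a topology \<Rightarrow> 'a chart set \<Rightarrow> (real \<Rightarrow> 'a) \<Rightarrow> bool" where
  "smooth_loop X A \<gamma> \<longleftrightarrow> continuous_map euclideanreal X \<gamma> \<and> (\<forall>t. \<gamma> (t + 1) = \<gamma> t) \<and>
     (\<forall>(U, \<phi>)\<in>A. smooth_on {t. \<gamma> t \<in> U} (\<phi> \<circ> \<gamma>))"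

definition loop_class :: "'a topology \<Rightarrow> (real \<Rightarrow> 'a) \<Rightarrow> 'a chain set" where
  "loop_class X \<gamma> = mod2_homology_class 1 X (frag_of (\<lambda>x\<in>standard_simplex 1. \<gamma> (x 1)))"

definition transverse_loops :: "'a chart set \<Rightarrow> (real \<Rightarrow> 'a) \<Rightarrow> (real \<Rightarrow> 'a) \<Rightarrow> bool" where
  "transverse_loops A \<gamma> \<delta> \<longleftrightarrow>
     (\<forall>s t. \<gamma> s = \<delta> t \<longrightarrow> (\<forall>(U, \<phi>)\<in>A. \<gamma> s \<in> U \<longrightarrow>
        span {vector_derivative (\<phi> \<circ> \<gamma>) (at s), vector_derivative (\<phi> \<circ> \<delta>) (at t)} = UNIV))"

text \<open>The parity of the number of intersection points, counted with multiplicity, of transverse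
  smooth closed curves representing the two classes. On a closed connected surface such curves
  exist for any two classes, and the parity does not depend on their choice.\<close>
definition intersection_number ::
    "'a topology \<Rightarrow> 'a chart set \<Rightarrow> 'a chain set \<Rightarrow> 'a chain set \<Rightarrow> bit" where
  "intersection_number X A x y =
     (THE n. \<exists>\<gamma> \<delta>. smooth_loop X A \<gamma> \<and> smooth_loop X A \<delta> \<and>
        loop_class X \<gamma> = x \<and> loop_class X \<delta> = y \<and> transverse_loops A \<gamma> \<delta> \<and>
        n = of_nat (card {(s, t). s \<in> {0..<1} \<and> t \<in> {0..<1} \<and> \<gamma> s = \<delta> t}))"

section \<open>Quadratic forms and the Arf invariant\<close>

text \<open>A function \<open>H\<^sub>1 \<rightarrow> \<int>/2\<close> is represented by the total function extending it by 0, so that sums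
  and equality of functions are pointwise.\<close>
definition functions_on_H1 :: "'a topology \<Rightarrow> ('a chain set \<Rightarrow> bit) set" where
  "functions_on_H1 X = {h. \<forall>x. x \<notin> carrier (H1 X) \<longrightarrow> h x = 0}"

definition quadratic_form :: "'a topology \<Rightarrow> 'a chart set \<Rightarrow> ('a chain set \<Rightarrow> bit) \<Rightarrow> bool" where
  "quadratic_form X A q \<longleftrightarrow> q \<in> functions_on_H1 X \<and>
     (\<forall>x\<in>carrier (H1 X). \<forall>y\<in>carrier (H1 X).
        q (x \<otimes>\<^bsub>H1 X\<^esub> y) = q x + q y + intersection_number X A x y)"

definition pull_back :: "'a topology \<Rightarrow> ('a \<Rightarrow> 'a) \<Rightarrow> ('a chain set \<Rightarrow> bit) \<Rightarrow> 'a chain set \<Rightarrow> bit" where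
  "pull_back X f q = (\<lambda>x. if x \<in> carrier (H1 X) then q (H1_map X f x) else 0)"

definition invariant_under :: "'a topology \<Rightarrow> ('a \<Rightarrow> 'a) \<Rightarrow> ('a chain set \<Rightarrow> bit) \<Rightarrow> bool" where
  "invariant_under X f q \<longleftrightarrow> pull_back X f q = q"

text \<open>The first conjunct says that \<open>a\<^sub>1, b\<^sub>1, \<dots>, a\<^sub>g, b\<^sub>g\<close> is a basis: every element is a linear
  combination with coefficients in \<open>\<int>/2\<close>, i.e. a sum over a subset, in a unique way.\<close>
definition symplectic_basis ::
    "'a topology \<Rightarrow> 'a chart set \<Rightarrow> nat \<Rightarrow> (nat \<Rightarrow> 'a chain set) \<Rightarrow> (nat \<Rightarrow> 'a chain set) \<Rightarrow> bool" where
  "symplectic_basis X A g a b \<longleftrightarrow>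
     (\<forall>i\<in>{1..g}. a i \<in> carrier (H1 X) \<and> b i \<in> carrier (H1 X)) \<and>
     bij_betw (\<lambda>(I, J). finprod (H1 X) a I \<otimes>\<^bsub>H1 X\<^esub> finprod (H1 X) b J)
       (Pow {1..g} \<times> Pow {1..g}) (carrier (H1 X)) \<and>
     (\<forall>i\<in>{1..g}. \<forall>j\<in>{1..g}.
        (intersection_number X A (a i) (b j) = 1 \<longleftrightarrow> i = j) \<and>
        intersection_number X A (a i) (a j) = 0 \<and>
        intersection_number X A (b i) (b j) = 0)"

text \<open>For a quadratic form \<open>q\<close> the value does not depend on the choice of the symplectic basis.\<close>
definition Arf :: "'a topology \<Rightarrow> 'a chart set \<Rightarrow> nat \<Rightarrow> ('a chain set \<Rightarrow> bit) \<Rightarrow> bit" where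
  "Arf X A g q =
     (let (a, b) = (SOME (a, b). symplectic_basis X A g a b) in \<Sum>i=1..g. q (a i) * q (b i))"

text \<open>Over \<open>\<int>/2\<close> additive maps are linear.\<close>
definition linear_functional :: "'a topology \<Rightarrow> ('a chain set \<Rightarrow> bit) \<Rightarrow> bool" where
  "linear_functional X \<xi> \<longleftrightarrow> \<xi> \<in> functions_on_H1 X \<and>
     (\<forall>x\<in>carrier (H1 X). \<forall>y\<in>carrier (H1 X). \<xi> (x \<otimes>\<^bsub>H1 X\<^esub> y) = \<xi> x + \<xi> y)"

text \<open>The linear maps \<open>\<xi>\<close> with \<open>\<xi> \<circ> (f\<^sub>* - id) = 0\<close>.\<close>
definition invariant_functionals :: "'a topology \<Rightarrow> ('a \<Rightarrow> 'a) \<Rightarrow> ('a chain set \<Rightarrow> bit) set" where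
  "invariant_functionals X f =
     {\<xi>. linear_functional X \<xi> \<and>
         (\<forall>x\<in>carrier (H1 X). \<xi> (H1_map X f x \<otimes>\<^bsub>H1 X\<^esub> inv\<^bsub>H1 X\<^esub> x) = 0)}"

definition functional_basis ::
    "'a topology \<Rightarrow> ('a chain set \<Rightarrow> bit) set \<Rightarrow> nat \<Rightarrow> (nat \<Rightarrow> 'a chain set \<Rightarrow> bit) \<Rightarrow> bool" where
  "functional_basis X W d \<xi> \<longleftrightarrow>
     (\<forall>i\<in>{1..d}. \<xi> i \<in> W) \<and>
     (\<forall>c :: nat \<Rightarrow> bit. (\<lambda>x. \<Sum>i=1..d. c i * \<xi> i x) = (\<lambda>x. 0) \<longrightarrow> (\<forall>i\<in>{1..d}. c i = 0)) \<and>
     (\<forall>\<eta>\<in>W. \<exists>c :: nat \<Rightarrow> bit. \<eta> = (\<lambda>x. \<Sum>i=1..d. c i * \<xi> i x))"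

end

theory Submission
  imports Defs
begin

text \<open>The invariant quadratic forms are exactly the forms \<open>q\<^sub>0 + \<xi>\<close> with \<open>\<xi>\<close> an invariant functional.
  Whatever the chosen basis, \<open>Arf\<close> is a polynomial function of degree at most 2, so its second
  difference at \<open>q\<^sub>0\<close> is a bilinear form \<open>B\<close> in the functionals. If \<open>Arf\<close> takes the value 1
  at \<open>q\<^sub>0\<close>, all \<open>q\<^sub>0 + \<xi>\<^sub>i\<close> and all \<open>q\<^sub>0 + \<xi>\<^sub>i + \<xi>\<^sub>j\<close>, then \<open>B(\<xi>\<^sub>i, \<xi>\<^sub>j) = 0\<close> for
  \<open>i \<noteq> j\<close>, and adding basis functionals one at a time never changes the value 1.\<close>

section \<open>Homology with coefficients in \<open>\<int>/2\<close>\<close>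

lemma frag_cmul_minus_right: "frag_cmul k (- x) = - frag_cmul k x"
  by (rule poly_mapping_eqI) simp

lemma comm_group_mod2_cycle_group: "comm_group (mod2_cycle_group p X)"
proof (rule comm_groupI)
  fix x y
  assume "x \<in> carrier (mod2_cycle_group p X)" "y \<in> carrier (mod2_cycle_group p X)"
  then obtain d e where "singular_chain p X x" "singular_chain p X y"
    "singular_chain (p - 1) X d" "chain_boundary p x = frag_cmul 2 d"
    "singular_chain (p - 1) X e" "chain_boundary p y = frag_cmul 2 e"
    by (auto simp: mod2_cycle_group_def)
  then show "x \<otimes>\<^bsub>mod2_cycle_group p X\<^esub> y \<in> carrier (mod2_cycle_group p X)"
    by (auto simp: mod2_cycle_group_def singular_chain_add chain_boundary_add
        frag_cmul_distrib2 intro!: exI[of _ "d + e"])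
next
  show "\<one>\<^bsub>mod2_cycle_group p X\<^esub> \<in> carrier (mod2_cycle_group p X)"
    by (auto simp: mod2_cycle_group_def intro!: exI[of _ 0])
next
  fix x
  assume "x \<in> carrier (mod2_cycle_group p X)"
  then obtain d where "singular_chain p X x"
    "singular_chain (p - 1) X d" "chain_boundary p x = frag_cmul 2 d"
    by (auto simp: mod2_cycle_group_def)
  then have "- x \<in> carrier (mod2_cycle_group p X)"
    by (auto simp: mod2_cycle_group_def chain_boundary_minus frag_cmul_minus_right
        intro!: exI[of _ "- d"] singular_chain_minus[THEN iffD2])
  then show "\<exists>y\<in>carrier (mod2_cycle_group p X). y \<otimes>\<^bsub>mod2_cycle_group p X\<^esub> x = \<one>\<^bsub>mod2_cycle_group p X\<^esub>"
    by (intro bexI[of _ "- x"]) (simp_all add: mod2_cycle_group_def)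
qed (simp_all add: mod2_cycle_group_def algebra_simps)

lemma mod2_boundaries_subset: "mod2_boundaries p X \<subseteq> carrier (mod2_cycle_group p X)"
proof
  fix c assume "c \<in> mod2_boundaries p X"
  then obtain e d where ed: "singular_chain (Suc p) X e" "singular_chain p X d"
    and c: "c = chain_boundary (Suc p) e + frag_cmul 2 d"
    by (auto simp: mod2_boundaries_def)
  have "singular_chain p X c"
    using ed singular_chain_boundary[of "Suc p" X e]
    by (simp add: c singular_chain_add singular_chain_cmul)
  \<comment> \<open>The part \<open>chain_boundary (Suc p) e\<close> vanishes because the boundary
    squares to zero, so the witness for a mod 2 cycle is the boundary of \<open>d\<close>.\<close>
  moreover have "chain_boundary p c = frag_cmul 2 (chain_boundary p d)"
    using ed chain_boundary_boundary[of "Suc p" X e]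
    by (simp add: c chain_boundary_add chain_boundary_cmul)
  ultimately show "c \<in> carrier (mod2_cycle_group p X)"
    using singular_chain_boundary[of p X d] ed by (auto simp: mod2_cycle_group_def)
qed

text \<open>In a commutative group every subgroup is normal, so closure under sums and negation
  suffices. This makes the homology quotient a group.\<close>

lemma normal_mod2_boundaries: "mod2_boundaries p X \<lhd> mod2_cycle_group p X"
proof -
  interpret comm_group "mod2_cycle_group p X"
    by (rule comm_group_mod2_cycle_group)
  show ?thesis
  proof (rule subgroup_imp_normal, rule subgroupI)
    have "chain_boundary (Suc p) 0 + frag_cmul 2 0 \<in> mod2_boundaries p X"
      unfolding mod2_boundaries_def using singular_chain_0 by blast
    then show "mod2_boundaries p X \<noteq> {}" by blast
  next
    fix c assume c: "c \<in> mod2_boundaries p X"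
    then obtain e d where ed: "singular_chain (Suc p) X e" "singular_chain p X d"
      "c = chain_boundary (Suc p) e + frag_cmul 2 d"
      by (auto simp: mod2_boundaries_def)
    then have "- c = chain_boundary (Suc p) (- e) + frag_cmul 2 (- d)"
      by (simp add: chain_boundary_minus frag_cmul_minus_right)
    then have m: "- c \<in> mod2_boundaries p X"
      using ed unfolding mod2_boundaries_def by (auto intro: singular_chain_minus[THEN iffD2])
    have "inv\<^bsub>mod2_cycle_group p X\<^esub> c = - c"
      using mod2_boundaries_subset c m
      by (intro inv_equality) (auto simp: mod2_cycle_group_def)
    with m show "inv\<^bsub>mod2_cycle_group p X\<^esub> c \<in> mod2_boundaries p X" by simp
  next
    fix c c' assume "c \<in> mod2_boundaries p X" "c' \<in> mod2_boundaries p X"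
    then obtain e d e' d' where ed: "singular_chain (Suc p) X e" "singular_chain p X d"
      "c = chain_boundary (Suc p) e + frag_cmul 2 d"
      "singular_chain (Suc p) X e'" "singular_chain p X d'"
      "c' = chain_boundary (Suc p) e' + frag_cmul 2 d'"
      unfolding mod2_boundaries_def by blast
    then have "c + c' = chain_boundary (Suc p) (e + e') + frag_cmul 2 (d + d')"
      by (simp add: chain_boundary_add frag_cmul_distrib2)
    moreover have "singular_chain (Suc p) X (e + e')" "singular_chain p X (d + d')"
      using ed by (auto intro: singular_chain_add)
    ultimately have "c + c' \<in> mod2_boundaries p X"
      unfolding mod2_boundaries_def by blast
    then show "c \<otimes>\<^bsub>mod2_cycle_group p X\<^esub> c' \<in> mod2_boundaries p X"
      by (simp add: mod2_cycle_group_def)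
  qed (rule mod2_boundaries_subset)
qed

lemma group_mod2_homology_group: "group (mod2_homology_group p X)"
  unfolding mod2_homology_group_def by (rule normal.factorgroup_is_group[OF normal_mod2_boundaries])

lemma chain_map_mod2_cycle:
  assumes "continuous_map X Y f" "c \<in> carrier (mod2_cycle_group p X)"
  shows "chain_map p f c \<in> carrier (mod2_cycle_group p Y)"
proof -
  from assms(2) obtain d where d: "singular_chain p X c" "singular_chain (p - 1) X d"
    "chain_boundary p c = frag_cmul 2 d"
    by (auto simp: mod2_cycle_group_def)
  then have "chain_boundary p (chain_map p f c) = frag_cmul 2 (chain_map (p - 1) f d)"
    by (simp add: chain_boundary_chain_map chain_map_cmul)
  with d assms(1) show ?thesis
    by (auto simp: mod2_cycle_group_def intro: singular_chain_chain_map)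
qed

lemma chain_map_mod2_boundary:
  assumes "continuous_map X Y f" "c \<in> mod2_boundaries p X"
  shows "chain_map p f c \<in> mod2_boundaries p Y"
proof -
  from assms(2) obtain e d where ed: "singular_chain (Suc p) X e" "singular_chain p X d"
    "c = chain_boundary (Suc p) e + frag_cmul 2 d"
    by (auto simp: mod2_boundaries_def)
  then have "chain_map p f c =
      chain_boundary (Suc p) (chain_map (Suc p) f e) + frag_cmul 2 (chain_map p f d)"
    using chain_boundary_chain_map[of "Suc p" X e f]
    by (simp add: chain_map_add chain_map_cmul)
  with ed assms(1) show ?thesis
    unfolding mod2_boundaries_def by (blast intro: singular_chain_chain_map)
qed

text \<open>Chain maps send mod 2 boundaries to mod 2 boundaries, so all cosets in the union
  defining \<open>mod2_hom_induced\<close> coincide and the union is a single class.\<close>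

lemma mod2_hom_induced_in_carrier:
  assumes f: "continuous_map X Y f" and x: "x \<in> carrier (mod2_homology_group p X)"
  shows "mod2_hom_induced p Y f x \<in> carrier (mod2_homology_group p Y)"
proof -
  interpret Y: normal "mod2_boundaries p Y" "mod2_cycle_group p Y"
    by (rule normal_mod2_boundaries)
  interpret X: normal "mod2_boundaries p X" "mod2_cycle_group p X"
    by (rule normal_mod2_boundaries)
  obtain c where c: "c \<in> carrier (mod2_cycle_group p X)"
    and xc: "x = mod2_boundaries p X #>\<^bsub>mod2_cycle_group p X\<^esub> c"
    using x by (auto simp: mod2_homology_group_def carrier_FactGroup)
  have "mod2_homology_class p Y (chain_map p f c') = mod2_homology_class p Y (chain_map p f c)"
    if "c' \<in> x" for c'
  proof -
    from that obtain b where b: "b \<in> mod2_boundaries p X" "c' = b + c"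
      by (auto simp: xc r_coset_def mod2_cycle_group_def)
    have "chain_map p f c' = chain_map p f b \<otimes>\<^bsub>mod2_cycle_group p Y\<^esub> chain_map p f c"
      by (simp add: b chain_map_add mod2_cycle_group_def)
    then have "chain_map p f c' \<in> mod2_boundaries p Y #>\<^bsub>mod2_cycle_group p Y\<^esub> chain_map p f c"
      using chain_map_mod2_boundary[OF f b(1)] by (auto simp: r_coset_def)
    then show ?thesis
      unfolding mod2_homology_class_def
      using chain_map_mod2_cycle[OF f c] Y.is_subgroup by (rule Y.repr_independence[symmetric])
  qed
  moreover have "c \<in> x"
    unfolding xc by (rule X.rcos_self[OF c X.is_subgroup])
  ultimately have "mod2_hom_induced p Y f x = mod2_homology_class p Y (chain_map p f c)"
    unfolding mod2_hom_induced_def by blast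
  then show ?thesis
    using chain_map_mod2_cycle[OF f c]
    by (auto simp: mod2_homology_class_def mod2_homology_group_def carrier_FactGroup)
qed

section \<open>Invariant quadratic forms\<close>

text \<open>Keeps \<open>+\<close> and \<open>*\<close> on \<open>bit\<close> as ring operations, so
  that the laws for rings and finite sums apply.\<close>

declare add_bit_eq_xor [simp del] mult_bit_eq_and [simp del]

lemma bit_add_self [simp]: "(x :: bit) + x = 0"
  by (cases x) simp_all

lemma bit_add_eq_0_iff: "(x :: bit) + y = 0 \<longleftrightarrow> x = y"
  by (cases x; cases y) simp_all

text \<open>An additive map into \<int>/2 takes equal values at a group element and its inverse, so
  vanishing on the difference of \<open>H1_map X f x\<close> and \<open>x\<close> means equality of
  the two values.\<close>

lemma linear_functional_invariant_iff:
  assumes f: "continuous_map X X f" and \<xi>: "linear_functional X \<xi>"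
  shows "\<xi> \<in> invariant_functionals X f \<longleftrightarrow> (\<forall>x\<in>carrier (H1 X). \<xi> (H1_map X f x) = \<xi> x)"
proof -
  interpret group "H1 X" by (rule group_mod2_homology_group)
  have add: "\<xi> (x \<otimes>\<^bsub>H1 X\<^esub> y) = \<xi> x + \<xi> y"
    if "x \<in> carrier (H1 X)" "y \<in> carrier (H1 X)" for x y
    using \<xi> that by (auto simp: linear_functional_def)
  \<comment> \<open>\<open>H1\<close> abbreviates homology in degree \<open>1\<close>; without
    \<open>One_nat_def\<close> the goals keep the form in which the group laws were
    interpreted.\<close>
  have one: "\<xi> \<one>\<^bsub>H1 X\<^esub> = 0"
    using add[of "\<one>\<^bsub>H1 X\<^esub>" "\<one>\<^bsub>H1 X\<^esub>"] by (simp del: One_nat_def)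
  have "\<xi> (inv\<^bsub>H1 X\<^esub> x) = \<xi> x" if "x \<in> carrier (H1 X)" for x
    using add[of "inv\<^bsub>H1 X\<^esub> x" x] that one by (simp add: bit_add_eq_0_iff del: One_nat_def)
  then have "\<xi> (H1_map X f x \<otimes>\<^bsub>H1 X\<^esub> inv\<^bsub>H1 X\<^esub> x) = \<xi> (H1_map X f x) + \<xi> x"
    if "x \<in> carrier (H1 X)" for x
    using that add[of "H1_map X f x" "inv\<^bsub>H1 X\<^esub> x"] mod2_hom_induced_in_carrier[OF f that]
    by (simp del: One_nat_def)
  with \<xi> show ?thesis
    by (auto simp: invariant_functionals_def bit_add_eq_0_iff)
qed

lemma invariant_under_iff:
  assumes "q \<in> functions_on_H1 X"
  shows "invariant_under X f q \<longleftrightarrow> (\<forall>x\<in>carrier (H1 X). q (H1_map X f x) = q x)"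
  using assms by (auto simp: invariant_under_def pull_back_def functions_on_H1_def fun_eq_iff)

text \<open>Adding an additive map leaves the intersection term of the quadratic law
  unchanged.\<close>

lemma add_invariant_functional:
  assumes f: "continuous_map X X f" and q: "quadratic_form X A q" "invariant_under X f q"
    and \<xi>: "\<xi> \<in> invariant_functionals X f"
  shows "quadratic_form X A (\<lambda>x. q x + \<xi> x)" "invariant_under X f (\<lambda>x. q x + \<xi> x)"
proof -
  have lin: "linear_functional X \<xi>" using \<xi> by (simp add: invariant_functionals_def)
  show 1: "quadratic_form X A (\<lambda>x. q x + \<xi> x)"
    using q lin by (auto simp: quadratic_form_def linear_functional_def functions_on_H1_def)
  show "invariant_under X f (\<lambda>x. q x + \<xi> x)"
    using q 1 \<xi> by (simp add: invariant_under_iff quadratic_form_def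
        linear_functional_invariant_iff[OF f lin])
qed

text \<open>Both forms have the same intersection term, which cancels in characteristic 2 and leaves
  an additive map. With the preceding lemma, the invariant forms are a coset of the invariant
  functionals.\<close>

lemma diff_invariant_quadratic_forms:
  assumes f: "continuous_map X X f" and q: "quadratic_form X A q" "invariant_under X f q"
    and q0: "quadratic_form X A q0" "invariant_under X f q0"
  shows "(\<lambda>x. q x + q0 x) \<in> invariant_functionals X f"
proof -
  have "linear_functional X (\<lambda>x. q x + q0 x)"
    using q q0 by (auto simp: quadratic_form_def linear_functional_def functions_on_H1_def)
  from linear_functional_invariant_iff[OF f this] q q0 show ?thesis
    by (simp add: invariant_under_iff quadratic_form_def)
qed

section \<open>Polynomials of degree two over \<open>\<int>/2\<close>\<close>

text \<open>\<open>F\<close> stands for the Arf sum over an arbitrary family of pairs of points.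
  Induction on \<open>T\<close> works because the new index \<open>j\<close> differs from every
  earlier one, so hypothesis \<open>2\<close> covers each mixed pair.\<close>

lemma quadratic_sum_eq_1:
  fixes q :: "'b \<Rightarrow> bit" and \<xi> :: "'i \<Rightarrow> 'b \<Rightarrow> bit" and a b :: "'k \<Rightarrow> 'b" and K :: "'k set"
  defines "F \<equiv> \<lambda>h :: 'b \<Rightarrow> bit. \<Sum>k\<in>K. h (a k) * h (b k)"
  assumes 0: "F q = 1" and 1: "\<And>i. i \<in> S \<Longrightarrow> F (\<lambda>x. q x + \<xi> i x) = 1"
    and 2: "\<And>i j. i \<in> S \<Longrightarrow> j \<in> S \<Longrightarrow> i \<noteq> j \<Longrightarrow> F (\<lambda>x. q x + \<xi> i x + \<xi> j x) = 1"
    and "finite T" "T \<subseteq> S"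
  shows "F (\<lambda>x. q x + (\<Sum>i\<in>T. \<xi> i x)) = 1"
  using \<open>finite T\<close> \<open>T \<subseteq> S\<close>
proof (induction T rule: finite_induct)
  case empty
  then show ?case using 0 by simp
next
  case (insert j T)
  \<comment> \<open>The polar form of \<open>F\<close>, that is, its second difference.\<close>
  define B where "B = (\<lambda>h h' :: 'b \<Rightarrow> bit. \<Sum>k\<in>K. h (a k) * h' (b k) + h' (a k) * h (b k))"
  have eq: "(x + y + z) * (x' + y' + z') =
      (x + y) * (x' + y') + (x + z) * (x' + z') + x * x' + (y * z' + z * y')"
    for x y z x' y' z' :: bit
    by (cases x; cases y; cases z; cases x'; cases y'; cases z') simp_all
  have F: "F (\<lambda>x. q x + h x + h' x) = F (\<lambda>x. q x + h x) + F (\<lambda>x. q x + h' x) + F q + B h h'"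
    for h h'
    unfolding F_def B_def by (simp add: eq sum.distrib)
  \<comment> \<open>All four values of \<open>F\<close> in the identity are 1 here, and four ones
    sum to 0 in \<int>/2.\<close>
  have "B (\<xi> i) (\<xi> j) = 0" if "i \<in> T" for i
    using F[of "\<xi> i" "\<xi> j"] 0 1[of i] 1[of j] 2[of i j] that insert by (auto simp: subset_iff)
  moreover have "B (\<lambda>x. \<Sum>i\<in>T. \<xi> i x) (\<xi> j) = (\<Sum>i\<in>T. B (\<xi> i) (\<xi> j))"
    unfolding B_def
    by (subst sum.swap) (simp add: sum.distrib sum_distrib_left sum_distrib_right)
  ultimately have "B (\<lambda>x. \<Sum>i\<in>T. \<xi> i x) (\<xi> j) = 0" by simp
  \<comment> \<open>The induction hypothesis, \<open>1\<close> and \<open>0\<close> give three ones,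
    whose sum is 1.\<close>
  then have "F (\<lambda>x. q x + (\<Sum>i\<in>T. \<xi> i x) + \<xi> j x) = 1"
    using F[of "\<lambda>x. \<Sum>i\<in>T. \<xi> i x" "\<xi> j"] 0 1[of j] insert by simp
  with insert show ?case by (simp add: ac_simps)
qed

text \<open>A coefficient in \<int>/2 only decides whether its term occurs. This turns basis
  expansions into the subset sums of \<open>quadratic_sum_eq_1\<close>.\<close>

lemma bit_combination_eq_subset_sum:
  fixes c :: "'i \<Rightarrow> bit"
  assumes "finite S"
  shows "(\<Sum>i\<in>S. c i * h i) = (\<Sum>i\<in>{i \<in> S. c i = 1}. h i)"
proof -
  have "c i * h i = (if c i = 1 then h i else 0)" for i
    by (cases "c i") simp_all
  with assms show ?thesis by (simp add: sum.inter_filter)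
qed

theorem proposition3p4:
  fixes X :: "'a topology" and A :: "'a chart set" and g d :: nat and f :: "'a \<Rightarrow> 'a"
    and q0 :: "'a chain set \<Rightarrow> bit" and \<xi> :: "nat \<Rightarrow> 'a chain set \<Rightarrow> bit"
  assumes "oriented_closed_connected_surface X A" and "has_genus X g" and "g \<ge> 1"
    and "orientation_preserving_diffeo X A f"
    and "quadratic_form X A q0" and "invariant_under X f q0"
    and "functional_basis X (invariant_functionals X f) d \<xi>"
  shows "(\<exists>q. quadratic_form X A q \<and> invariant_under X f q \<and> Arf X A g q = 0) \<longleftrightarrow>
     0 \<in> {Arf X A g q0} \<union>
         {Arf X A g (\<lambda>x. q0 x + \<xi> i x) |i. i \<in> {1..d}} \<union>
         {Arf X A g (\<lambda>x. q0 x + \<xi> i x + \<xi> j x) |i j. i \<in> {1..d} \<and> j \<in> {1..d} \<and> i \<noteq> j}"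
proof -
  have f: "continuous_map X X f"
    using assms(4) by (simp add: orientation_preserving_diffeo_def smooth_self_map_def)
  have \<xi>: "\<xi> i \<in> invariant_functionals X f" if "i \<in> {1..d}" for i
    using assms(7) that by (simp add: functional_basis_def)
  note add = add_invariant_functional[OF f]
  \<comment> \<open>Naming the chosen pair once fixes it for all forms, so \<open>Arf\<close>
    becomes one sum of products of values.\<close>
  obtain a b where "(SOME (a, b). symplectic_basis X A g a b) = (a, b)"
    by fastforce
  then have Arf: "Arf X A g = (\<lambda>q. \<Sum>i=1..g. q (a i) * q (b i))"
    unfolding Arf_def by simp
  show ?thesis (is "?L \<longleftrightarrow> 0 \<in> ?R")
  proof
    assume ?L
    then obtain q where q: "quadratic_form X A q" "invariant_under X f q" "Arf X A g q = 0"
      by blast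
    obtain c :: "nat \<Rightarrow> bit" where "(\<lambda>x. q x + q0 x) = (\<lambda>x. \<Sum>i=1..d. c i * \<xi> i x)"
      using diff_invariant_quadratic_forms[OF f q(1,2) assms(5,6)] assms(7)
      unfolding functional_basis_def by blast
    then have "q x + q0 x = (\<Sum>i\<in>{i \<in> {1..d}. c i = 1}. \<xi> i x)" for x
      by (simp add: fun_eq_iff bit_combination_eq_subset_sum)
    \<comment> \<open>Adding \<open>q0 x\<close> again cancels it, as every element of \<int>/2 is
      its own negative.\<close>
    then have q_eq: "q = (\<lambda>x. q0 x + (\<Sum>i\<in>{i \<in> {1..d}. c i = 1}. \<xi> i x))"
      by (metis (no_types, lifting) add.commute add.left_commute add.right_neutral bit_add_self ext)
    show "0 \<in> ?R"
    proof (rule ccontr)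
      assume "0 \<notin> ?R"
      then have ne: "0 \<noteq> Arf X A g q0"
        "\<And>i. i \<in> {1..d} \<Longrightarrow> 0 \<noteq> Arf X A g (\<lambda>x. q0 x + \<xi> i x)"
        "\<And>i j. i \<in> {1..d} \<Longrightarrow> j \<in> {1..d} \<Longrightarrow> i \<noteq> j \<Longrightarrow>
          0 \<noteq> Arf X A g (\<lambda>x. q0 x + \<xi> i x + \<xi> j x)"
        by blast+
      have "1 = z" if "0 \<noteq> z" for z :: bit
        using that by (cases z) simp_all
      note ne = ne[THEN this, symmetric]
      have "Arf X A g q = 1"
        unfolding q_eq Arf
        by (rule quadratic_sum_eq_1[where S = "{1..d}", OF ne[unfolded Arf]]) auto
      with q(3) show False by simp
    qed
  next
    assume "0 \<in> ?R"
    then consider "Arf X A g q0 = 0"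
      | i where "i \<in> {1..d}" "Arf X A g (\<lambda>x. q0 x + \<xi> i x) = 0"
      | i j where "i \<in> {1..d}" "j \<in> {1..d}" "Arf X A g (\<lambda>x. q0 x + \<xi> i x + \<xi> j x) = 0"
      by auto
    then show ?L
    proof cases
      case 1
      with assms(5,6) show ?thesis by blast
    next
      case 2
      with add[OF assms(5,6) \<xi>] show ?thesis by blast
    next
      \<comment> \<open>The form with one functional added is again invariant and quadratic, so the
        addition lemma applies a second time.\<close>
      case 3
      with add[OF add[OF assms(5,6) \<xi>] \<xi>] show ?thesis by blast
    qed
  qed
qed

end
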